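(* Let $\mathcal{K}$ be a finite simplicial complex in $\mathbb{R}^d$ with vertex set $V\subset\mathbb{R}^d$, let $k$ be a homology degree with $0\le k\le d$, and let $\lambda>0$. Let $\lambda\mathcal{K}$ be the simplicial complex with vertex set $\lambda V=\{\lambda x:x\in V\}$ whose simplices are the images under $x\mapsto\lambda x$ of the simplices of $\mathcal{K}$. Then $$\mathrm{PET}^{(k)}_{\lambda\mathcal{K}}=\mathrm{PET}^{(k)}_{\mathcal{K}}$$ as functions on $S^{d-1}$.
   Context: A simplicial complex $\mathcal{K}$ in $\mathbb{R}^d$ with finite vertex set $V\subset\mathbb{R}^d$ is a finite collection of simplices (convex hulls of affinely independent subsets of $V$) closed under taking faces and such that any two simplices intersect in a common face or not at all. For $v\in S^{d-1}$ (the unit sphere in $\mathbb{R}^d$), the directional height function is $f_v:V\to\mathbb{R}$, $f_v(x)=\langle x,v\rangle$. Its lower-star filtration assigns to each simplex the maximum of $f_v$ over its vertices; the sublevel complex at $t$ is $\{\sigma\in\mathcal{K}:\max_{x\in\sigma}f_v(x)\le t\}$. $D_k(f_v)$ is the $k$-dimensional persistence diagram (persistent homology with coefficients in a fixed field) of this filtration, a finite multiset of pairs $(b_i,d_i)$, $i\in I$, with $b_i\le d_i$ finite; classes that never die are assigned death time $\max_{x\in V} f_v(x)$. Persistent entropy of a finite diagram $D=\{(b_i,d_i)\}_{i\in I}$: with $\ell_i=d_i-b_i$, $L=\sum_{i\in I}\ell_i$ and $p_i=\ell_i/L$, one sets $\mathrm{PE}(D)=-\sum_{i\in I}p_i\log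 p_i$, where $\log$ is the natural logarithm and $0\log 0=0$; if $D$ is empty or $L=0$, then $\mathrm{PE}(D)=0$. The persistent entropy transform of $\mathcal{K}$ in homology degree $k$ is the function $\mathrm{PET}^{(k)}_{\mathcal{K}}:S^{d-1}\to\mathbb{R}$, $v\mapsto \mathrm{PE}(D_k(f_v))$. *)

theory Defs
  imports
    "HOL-Analysis.Analysis"
    "HOL-Algebra.AbelCoset"
    "HOL-Combinatorics.Permutations"
    "HOL-Library.Multiset"
    "Jordan_Normal_Form.Missing_VectorSpace"
begin

text \<open>
  The library's \<^const>\<open>simplicial_complex\<close> counts the empty set as a (-1)-simplex and hence as a
  face of every simplex. This has no influence on homology in degrees \<open>k \<ge> 0\<close> as defined below:
  chains only see simplices with at least one vertex.
\<close>

definition simplicial_complex_on :: "'a::euclidean_space set \<Rightarrow> 'a set set \<Rightarrow> bool" where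
  "simplicial_complex_on V K \<longleftrightarrow>
     finite V \<and> simplicial_complex K \<and>
     (\<forall>\<sigma>\<in>K. \<exists>C\<subseteq>V. \<not> affine_dependent C \<and> \<sigma> = convex hull C)"

text \<open>The extreme points of \<open>convex hull C\<close>, for \<open>C\<close> affinely independent, are exactly the points
  of \<open>C\<close>.\<close>

definition simplex_vertices :: "'a::euclidean_space set \<Rightarrow> 'a set" where
  "simplex_vertices \<sigma> = {x. x extreme_point_of \<sigma>}"

definition scale_complex :: "real \<Rightarrow> 'a::euclidean_space set set \<Rightarrow> 'a set set" where
  "scale_complex c K = (\<lambda>\<sigma>. (*\<^sub>R) c ` \<sigma>) ` K"

definition height :: "'a::euclidean_space \<Rightarrow> 'a \<Rightarrow> real" where
  "height v x = x \<bullet> v"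

text \<open>The empty simplex, if present, belongs to every sublevel complex.\<close>

definition sublevel_complex :: "'a::euclidean_space set set \<Rightarrow> ('a \<Rightarrow> real) \<Rightarrow> real \<Rightarrow> 'a set set" where
  "sublevel_complex K f t = {\<sigma>\<in>K. \<sigma> \<noteq> {} \<longrightarrow> Max (f ` simplex_vertices \<sigma>) \<le> t}"

text \<open>
  We use oriented chains: a \<open>k\<close>-chain is an alternating function on the orderings
  \<open>(x\<^sub>0, \<dots>, x\<^sub>k)\<close> of the vertices of the \<open>k\<close>-simplices, extended by zero to all other lists. The
  value of a chain at an ordering is its coefficient at the correspondingly oriented simplex.
\<close>

definition ordered_simplices :: "'a::euclidean_space set set \<Rightarrow> nat \<Rightarrow> 'a list set" where
  "ordered_simplices K k =
     {xs. distinct xs \<and> length xs = Suc k \<and> (\<exists>\<sigma>\<in>K. set xs = simplex_vertices \<sigma>)}"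

definition chains ::
  "('f, 'm) ring_scheme \<Rightarrow> 'a::euclidean_space set set \<Rightarrow> nat \<Rightarrow> ('a list \<Rightarrow> 'f) set" where
  "chains F K k =
     {c. (\<forall>xs. c xs \<in> carrier F) \<and>
         (\<forall>xs. xs \<notin> ordered_simplices K k \<longrightarrow> c xs = \<zero>\<^bsub>F\<^esub>) \<and>
         (\<forall>xs\<in>ordered_simplices K k. \<forall>p. p permutes {..k} \<longrightarrow>
            c (permute_list p xs) = (if evenperm p then c xs else \<ominus>\<^bsub>F\<^esub> c xs))}"

definition chain_space ::
  "('f, 'm) ring_scheme \<Rightarrow> 'a::euclidean_space set set \<Rightarrow> nat \<Rightarrow> ('f, 'a list \<Rightarrow> 'f) module" where
  "chain_space F K k =
     \<lparr>carrier = chains F K k, monoid.mult = undefined, one = undefined,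
      zero = (\<lambda>_. \<zero>\<^bsub>F\<^esub>), add = (\<lambda>c c' xs. c xs \<oplus>\<^bsub>F\<^esub> c' xs),
      smult = (\<lambda>a c xs. a \<otimes>\<^bsub>F\<^esub> c xs)\<rparr>"

text \<open>
  The usual boundary
  \<open>\<partial>[x\<^sub>0, \<dots>, x\<^sub>k] = (\<Sum>i\<le>k. (-1)^i [x\<^sub>0, \<dots>, x\<^sub>i\<^sub>-\<^sub>1, x\<^sub>i\<^sub>+\<^sub>1, \<dots>, x\<^sub>k])\<close>, written in terms of
  coefficients. A given \<open>(k-1)\<close>-simplex \<open>[ys]\<close> is a face of exactly the \<open>k\<close>-simplices on
  \<open>x # ys\<close>, and it occurs in \<open>\<partial>[x # ys]\<close> with coefficient \<open>1\<close>. In degree \<open>0\<close> the boundary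
  vanishes, so the homology is unreduced.
\<close>

definition boundary_map ::
  "('f, 'm) ring_scheme \<Rightarrow> 'a::euclidean_space set set \<Rightarrow> nat \<Rightarrow> ('a list \<Rightarrow> 'f) \<Rightarrow> 'a list \<Rightarrow> 'f" where
  "boundary_map F K k c ys =
     (if k = 0 then \<zero>\<^bsub>F\<^esub>
      else \<Oplus>\<^bsub>F\<^esub>x\<in>{x. x # ys \<in> ordered_simplices K k}. c (x # ys))"

definition cycles ::
  "('f, 'm) ring_scheme \<Rightarrow> 'a::euclidean_space set set \<Rightarrow> nat \<Rightarrow> ('a list \<Rightarrow> 'f) set" where
  "cycles F K k = {c \<in> chains F K k. boundary_map F K k c = (\<lambda>_. \<zero>\<^bsub>F\<^esub>)}"

definition boundaries ::
  "('f, 'm) ring_scheme \<Rightarrow> 'a::euclidean_space set set \<Rightarrow> nat \<Rightarrow> ('a list \<Rightarrow> 'f) set" where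
  "boundaries F K k = boundary_map F K (Suc k) ` chains F K (Suc k)"

definition quotient_module :: "('f, 'b) module \<Rightarrow> 'b set \<Rightarrow> ('f, 'b set) module" where
  "quotient_module M W =
     \<lparr>carrier = a_rcosets\<^bsub>M\<^esub> W, monoid.mult = undefined, one = undefined,
      zero = W, add = (\<lambda>X Y. X <+>\<^bsub>M\<^esub> Y),
      smult = (\<lambda>a X. \<Union>x\<in>X. W +>\<^bsub>M\<^esub> (a \<odot>\<^bsub>M\<^esub> x))\<rparr>"

definition homology ::
  "('f, 'm) ring_scheme \<Rightarrow> 'a::euclidean_space set set \<Rightarrow> nat \<Rightarrow> ('f, ('a list \<Rightarrow> 'f) set) module" where
  "homology F K k =
     quotient_module ((chain_space F K k)\<lparr>carrier := cycles F K k\<rparr>) (boundaries F K k)"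

text \<open>The map \<open>H\<^sub>k(K) \<rightarrow> H\<^sub>k(L)\<close> induced by an inclusion \<open>K \<subseteq> L\<close>. It sends the class of a cycle
  \<open>z\<close> of \<open>K\<close> to the class of \<open>z\<close> in \<open>L\<close>.\<close>

definition inclusion_map ::
  "('f, 'm) ring_scheme \<Rightarrow> 'a::euclidean_space set set \<Rightarrow> nat \<Rightarrow>
     ('a list \<Rightarrow> 'f) set \<Rightarrow> ('a list \<Rightarrow> 'f) set" where
  "inclusion_map F L k X = (\<Union>z\<in>X. boundaries F L k +>\<^bsub>chain_space F L k\<^esub> z)"

definition persistent_betti ::
  "('f, 'm) ring_scheme \<Rightarrow> nat \<Rightarrow> 'a::euclidean_space set set \<Rightarrow> 'a set set \<Rightarrow> nat" where
  "persistent_betti F k K L =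
     vectorspace.dim F
       ((homology F L k)\<lparr>carrier := inclusion_map F L k ` carrier (homology F K k)\<rparr>)"

text \<open>
  For \<open>a\<^sub>1 < \<dots> < a\<^sub>m\<close> the values of \<open>f\<close> on \<open>V\<close>, the filtration is
  \<open>\<emptyset> = K\<^sub>0 \<subseteq> K\<^sub>1 \<subseteq> \<dots> \<subseteq> K\<^sub>m = K\<close>, where \<open>K\<^sub>i\<close> is the sublevel complex at \<open>a\<^sub>i\<close>.
\<close>

definition filtration_values :: "'a set \<Rightarrow> ('a \<Rightarrow> real) \<Rightarrow> nat \<Rightarrow> real" where
  "filtration_values V f i = sorted_list_of_set (f ` V) ! (i - 1)"

definition filtration ::
  "'a::euclidean_space set \<Rightarrow> 'a set set \<Rightarrow> ('a \<Rightarrow> real) \<Rightarrow> nat \<Rightarrow> 'a set set" where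
  "filtration V K f i = (if i = 0 then {} else sublevel_complex K f (filtration_values V f i))"

text \<open>
  With \<open>\<beta> i j\<close> the rank of \<open>H\<^sub>k(K\<^sub>i) \<rightarrow> H\<^sub>k(K\<^sub>j)\<close>, the number of classes born at \<open>a\<^sub>i\<close> and dying
  entering \<open>K\<^sub>j\<close> is \<open>(\<beta> i (j-1) - \<beta> i j) - (\<beta> (i-1) (j-1) - \<beta> (i-1) j)\<close>, and the number of
  classes born at \<open>a\<^sub>i\<close> that never die is \<open>\<beta> i m - \<beta> (i-1) m\<close>; none of these differences is
  negative. The latter classes are assigned the death time \<open>Max (f ` V)\<close>.
\<close>

definition persistence_diagram ::
  "('f, 'm) ring_scheme \<Rightarrow> nat \<Rightarrow> 'a::euclidean_space set \<Rightarrow> 'a set set \<Rightarrow> ('a \<Rightarrow> real) \<Rightarrow>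
     (real \<times> real) multiset" where
  "persistence_diagram F k V K f =
     (let m = card (f ` V);
          a = filtration_values V f;
          \<beta> = (\<lambda>i j. persistent_betti F k (filtration V K f i) (filtration V K f j))
      in (\<Sum>i\<in>{1..m}. \<Sum>j\<in>{i<..m}.
            replicate_mset ((\<beta> i (j - 1) - \<beta> i j) - (\<beta> (i - 1) (j - 1) - \<beta> (i - 1) j)) (a i, a j)) +
         (\<Sum>i\<in>{1..m}. replicate_mset (\<beta> i m - \<beta> (i - 1) m) (a i, Max (f ` V))))"

definition persistent_entropy :: "(real \<times> real) multiset \<Rightarrow> real" where
  "persistent_entropy D =
     (let L = (\<Sum>(b, d)\<in>#D. d - b);
          p = (\<lambda>(b, d). (d - b) / L)
      in if D = {#} \<or> L = 0 then 0
         else - (\<Sum>x\<in>#D. if p x = 0 then 0 else p x * ln (p x)))"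

definition PET ::
  "('f, 'm) ring_scheme \<Rightarrow> nat \<Rightarrow> 'a::euclidean_space set \<Rightarrow> 'a set set \<Rightarrow> 'a \<Rightarrow> real" where
  "PET F k V K =
     (\<lambda>v\<in>sphere 0 1. persistent_entropy (persistence_diagram F k V K (height v)))"

end

theory Submission
  imports Defs
begin

text \<open>
  Scaling by \<open>c > 0\<close> is a linear bijection \<open>g\<close>, and it multiplies every height by \<open>c\<close>, a strictly
  increasing operation on the reals. Two facts carry the proof.

  First, persistent homology only sees the combinatorics of the filtration. A linear bijection \<open>g\<close>
  maps the vertices of a simplex to the vertices of the image simplex, so relabelling the vertices
  by \<open>g\<close> carries chains to chains and commutes with the boundary operator
  (\<open>boundary_map_pushforward\<close>). If the new height function is \<open>\<phi> \<circ> f\<close> read along \<open>g\<close> with \<open>\<phi>\<close>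
  strictly increasing, the sublevel complexes at corresponding critical values correspond under
  \<open>g\<close>, so all ranks \<open>H\<^sub>k(K\<^sub>i) \<rightarrow> H\<^sub>k(K\<^sub>j)\<close> agree. Hence the new persistence diagram is the old one
  with \<open>\<phi>\<close> applied to all births and deaths (\<open>persistence_diagram_linear_image\<close>).

  Second, for \<open>\<phi>\<close> the multiplication by \<open>c\<close>, every lifetime and the total lifetime are multiplied by
  \<open>c\<close>. The entropy depends on the lifetimes only through their proportions
  (\<open>persistent_entropy_scale\<close>).

  The equality of ranks needs care because a rank is the dimension of the image of one quotient
  space in another. For \<open>K \<subseteq> L\<close> this image consists of the cosets of cycles of \<open>K\<close> modulo boundaries
  of \<open>L\<close> (\<open>persistent_betti_eq_dim_subquotient\<close>). It is therefore determined by two submodules of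
  one ambient space of functions, and an injective linear map of the ambient space preserves the
  dimension of such subquotients (\<open>dim_subquotient_image\<close>).
\<close>

section \<open>Dimensions of subquotients\<close>

text \<open>
  An isomorphism carries finite linear combinations to finite linear combinations with the same
  coefficients, so it maps spans to spans and generating sets to generating sets of the same size.
  The dimension is defined as the least size of a finite generating set, so it is preserved.
\<close>

lemma dim_linear_iso:
  assumes "linear_map F M N T" and bij: "bij_betw T (carrier M) (carrier N)"
  shows "vectorspace.dim F M = vectorspace.dim F N"
proof -
  interpret linear_map F M N T by fact
  have inj: "inj_on T (carrier M)" and onto: "T ` carrier M = carrier N"
    using bij by (auto simp: bij_betw_def)
  have span_image: "W.module.span (T ` A) = T ` V.module.span A" if A: "A \<subseteq> carrier M" for A
  proof (intro equalityI subsetI)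
    fix w assume "w \<in> W.module.span (T ` A)"
    then obtain B a where B: "finite B" "B \<subseteq> T ` A" "a \<in> B \<rightarrow> carrier F"
      and w: "w = W.module.lincomb a B"
      unfolding W.module.span_def by auto
    from B(1,2) obtain C where C: "C \<subseteq> A" "finite C" "B = T ` C"
      by (meson finite_subset_image)
    have "w = T (V.module.lincomb (a \<circ> T) C)"
      unfolding w C(3) using C A B(3) by (intro lincomb_linear_image inj) auto
    moreover have "V.module.lincomb (a \<circ> T) C \<in> V.module.span A"
      unfolding V.module.span_def using C B(3)
      by (intro CollectI exI[of _ "a \<circ> T"] exI[of _ C]) auto
    ultimately show "w \<in> T ` V.module.span A" by blast
  next
    fix w assume "w \<in> T ` V.module.span A"
    then obtain C a where C: "finite C" "C \<subseteq> A" "a \<in> C \<rightarrow> carrier F"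
      and w: "w = T (V.module.lincomb a C)"
      unfolding V.module.span_def by auto
    \<comment> \<open>The same coefficients, now indexed by the images of the vectors.\<close>
    define b where "b = a \<circ> the_inv_into C T"
    have inj_C: "inj_on T C"
      using inj C(2) A by (meson inj_on_subset order_trans)
    have b: "(b \<circ> T) x = a x" if "x \<in> C" for x
      using that by (simp add: b_def the_inv_into_f_f[OF inj_C])
    have "V.module.lincomb (b \<circ> T) C = V.module.lincomb a C"
      unfolding V.module.lincomb_def using b C(3) order_trans[OF C(2) A] by (intro V.module.M.finsum_cong') auto
    moreover have b_funcset: "b \<in> T ` C \<rightarrow> carrier F"
      using b C(3) by fastforce
    ultimately have "w = W.module.lincomb b (T ` C)"
      unfolding w using C A by (subst lincomb_linear_image) (auto intro!: inj)
    then show "w \<in> W.module.span (T ` A)"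
      unfolding W.module.span_def using C(1,2) b_funcset by blast
  qed
  have span_sub: "V.module.span A \<subseteq> carrier M" if "A \<subseteq> carrier M" for A
    using that V.span_closed by blast
  have gen: "W.module.span (T ` A) = carrier N \<longleftrightarrow> V.module.span A = carrier M" if "A \<subseteq> carrier M" for A
    unfolding span_image[OF that] onto[symmetric]
    using inj_on_image_eq_iff[OF inj span_sub[OF that] subset_refl] .
  have "(\<exists>A. finite A \<and> card A = n \<and> A \<subseteq> carrier M \<and> V.module.span A = carrier M) \<longleftrightarrow>
        (\<exists>B. finite B \<and> card B = n \<and> B \<subseteq> carrier N \<and> W.module.span B = carrier N)" for n
  proof
    assume "\<exists>A. finite A \<and> card A = n \<and> A \<subseteq> carrier M \<and> V.module.span A = carrier M"
    then obtain A where "finite A" "card A = n" "A \<subseteq> carrier M" "V.module.span A = carrier M" by blast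
    then show "\<exists>B. finite B \<and> card B = n \<and> B \<subseteq> carrier N \<and> W.module.span B = carrier N"
      using gen inj onto by (intro exI[of _ "T ` A"]) (auto simp: card_image inj_on_subset)
  next
    assume "\<exists>B. finite B \<and> card B = n \<and> B \<subseteq> carrier N \<and> W.module.span B = carrier N"
    then obtain B where B: "finite B" "card B = n" "B \<subseteq> carrier N" "W.module.span B = carrier N" by blast
    then obtain A where A: "A \<subseteq> carrier M" "finite A" "B = T ` A"
      using finite_subset_image[of B T "carrier M"] onto by blast
    then have "card A = n"
      using B(2) inj by (metis card_image inj_on_subset)
    then show "\<exists>A. finite A \<and> card A = n \<and> A \<subseteq> carrier M \<and> V.module.span A = carrier M"
      using A B(4) gen by blast
  qed
  then show ?thesis
    unfolding V.dim_def W.dim_def by simp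
qed

text \<open>
  For submodules \<open>W\<close> and \<open>S\<close> of \<open>M\<close> this is the image \<open>(S + W) / W\<close> of \<open>S\<close> in \<open>M / W\<close>. It is
  isomorphic to \<open>S / (S \<inter> W)\<close>. The image of one homology module in another has this form: \<open>S\<close>
  consists of the cycles of the small complex and \<open>W\<close> of the boundaries of the large one. Cosets of
  \<open>W\<close> are used because such boundaries need not be cycles of the small complex.
\<close>

definition subquotient :: "('f, 'b) module \<Rightarrow> 'b set \<Rightarrow> 'b set \<Rightarrow> ('f, 'b set) module" where
  "subquotient M W S = (quotient_module M W)\<lparr>carrier := (\<lambda>z. W +>\<^bsub>M\<^esub> z) ` S\<rparr>"

lemma subquotient_simps [simp]:
  "carrier (subquotient M W S) = (\<lambda>z. W +>\<^bsub>M\<^esub> z) ` S"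
  "zero (subquotient M W S) = W"
  "X \<oplus>\<^bsub>subquotient M W S\<^esub> Y = X <+>\<^bsub>M\<^esub> Y"
  "a \<odot>\<^bsub>subquotient M W S\<^esub> X = (\<Union>x\<in>X. W +>\<^bsub>M\<^esub> (a \<odot>\<^bsub>M\<^esub> x))"
  by (simp_all add: subquotient_def quotient_module_def)

lemma submodule_imp_abelian_subgroup:
  assumes "submodule R W M"
  shows "abelian_subgroup W M"
proof -
  interpret submodule R W M by fact
  interpret module R M by (rule module)
  have neg: "\<ominus>\<^bsub>M\<^esub> w \<in> W" if "w \<in> W" for w
  proof -
    have "w \<in> carrier M" using that subset by auto
    then have "\<ominus>\<^bsub>M\<^esub> w = (\<ominus>\<^bsub>R\<^esub> \<one>\<^bsub>R\<^esub>) \<odot>\<^bsub>M\<^esub> w" by (rule smult_minus_1[symmetric])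
    also have "\<dots> \<in> W"
      by (rule submodule.smult_closed[OF assms]) (use that in simp_all)
    finally show ?thesis .
  qed
  have "subgroup W (add_monoid M)"
    using subset neg by (intro subgroup.intro) (auto simp flip: a_inv_def)
  then show ?thesis
    by (intro abelian_subgroupI3 additive_subgroupI abelian_group_axioms)
qed

text \<open>
  The operations on cosets are computed on representatives. For scalar multiplication, all terms of
  the union coincide, because \<open>a \<odot> (w \<oplus> x)\<close> differs from \<open>a \<odot> x\<close> only by \<open>a \<odot> w \<in> W\<close>.
\<close>

lemma
  assumes W: "submodule R W M"
  shows coset_add: "\<lbrakk>x \<in> carrier M; y \<in> carrier M\<rbrakk> \<Longrightarrow>
      (W +>\<^bsub>M\<^esub> x) <+>\<^bsub>M\<^esub> (W +>\<^bsub>M\<^esub> y) = W +>\<^bsub>M\<^esub> (x \<oplus>\<^bsub>M\<^esub> y)"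
    and coset_smult: "\<lbrakk>a \<in> carrier R; x \<in> carrier M\<rbrakk> \<Longrightarrow>
      (\<Union>y\<in>W +>\<^bsub>M\<^esub> x. W +>\<^bsub>M\<^esub> (a \<odot>\<^bsub>M\<^esub> y)) = W +>\<^bsub>M\<^esub> (a \<odot>\<^bsub>M\<^esub> x)"
    and coset_zero: "W +>\<^bsub>M\<^esub> \<zero>\<^bsub>M\<^esub> = W"
proof -
  interpret submodule R W M by fact
  interpret module R M by (rule module)
  interpret W: abelian_subgroup W M using W by (rule submodule_imp_abelian_subgroup)
  show "(W +>\<^bsub>M\<^esub> x) <+>\<^bsub>M\<^esub> (W +>\<^bsub>M\<^esub> y) = W +>\<^bsub>M\<^esub> (x \<oplus>\<^bsub>M\<^esub> y)"
    if "x \<in> carrier M" "y \<in> carrier M"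
    using that by (rule W.a_rcos_sum)
  show "W +>\<^bsub>M\<^esub> \<zero>\<^bsub>M\<^esub> = W"
    using subset by simp
  show "(\<Union>y\<in>W +>\<^bsub>M\<^esub> x. W +>\<^bsub>M\<^esub> (a \<odot>\<^bsub>M\<^esub> y)) = W +>\<^bsub>M\<^esub> (a \<odot>\<^bsub>M\<^esub> x)"
    if a: "a \<in> carrier R" and x: "x \<in> carrier M"
  proof -
    have "W +>\<^bsub>M\<^esub> (a \<odot>\<^bsub>M\<^esub> y) = W +>\<^bsub>M\<^esub> (a \<odot>\<^bsub>M\<^esub> x)" if "y \<in> W +>\<^bsub>M\<^esub> x" for y
    proof -
      from that obtain w where w: "w \<in> W" "y = w \<oplus>\<^bsub>M\<^esub> x"
        by (auto simp: a_r_coset_def')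
      have "a \<odot>\<^bsub>M\<^esub> y = a \<odot>\<^bsub>M\<^esub> w \<oplus>\<^bsub>M\<^esub> a \<odot>\<^bsub>M\<^esub> x"
        using w a x subset by (auto intro!: smult_r_distr)
      moreover have "a \<odot>\<^bsub>M\<^esub> w \<in> W" using a w by simp
      ultimately have "a \<odot>\<^bsub>M\<^esub> y \<in> W +>\<^bsub>M\<^esub> (a \<odot>\<^bsub>M\<^esub> x)"
        by (auto simp: a_r_coset_def')
      then show ?thesis
        using a x a_repr_independence[OF _ _ W.a_subgroup] by (simp add: smult_closed)
    qed
    moreover have "x \<in> W +>\<^bsub>M\<^esub> x"
      using x by (rule W.a_rcos_self)
    ultimately show ?thesis by blast
  qed
qed

lemma module_subquotient:
  assumes W: "submodule R W M" and S: "submodule R S M"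
  shows "module R (subquotient M W S)"
proof -
  interpret S: submodule R S M by fact
  interpret module R M by (rule S.module)
  have S_neg: "\<exists>z'\<in>S. z' \<oplus>\<^bsub>M\<^esub> z = \<zero>\<^bsub>M\<^esub>" if "z \<in> S" for z
    using that submodule_imp_abelian_subgroup[OF S] S.subset
    by (intro bexI[of _ "\<ominus>\<^bsub>M\<^esub> z"])
      (auto simp: l_neg abelian_subgroup_def intro: additive_subgroup.a_inv_closed)
  note S.subset[THEN subsetD, simp] coset_add[OF W, simp] coset_smult[OF W, simp]
  have zero: "W \<in> (\<lambda>z. W +>\<^bsub>M\<^esub> z) ` S"
    using coset_zero[OF W] by (metis S.zero_closed imageI)
  have add0: "W <+>\<^bsub>M\<^esub> (W +>\<^bsub>M\<^esub> z) = W +>\<^bsub>M\<^esub> z" if "z \<in> S" for z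
    using coset_add[OF W zero_closed, of z] that by (simp add: coset_zero[OF W])
  show ?thesis
  proof (rule moduleI)
    show "cring R" by (rule is_cring)
    show "abelian_group (subquotient M W S)"
    proof (rule abelian_groupI, goal_cases)
      case (6 X)
      then obtain z where z: "z \<in> S" "X = W +>\<^bsub>M\<^esub> z" by auto
      then obtain z' where z': "z' \<in> S" "z' \<oplus>\<^bsub>M\<^esub> z = \<zero>\<^bsub>M\<^esub>" using S_neg by blast
      have "(W +>\<^bsub>M\<^esub> z') <+>\<^bsub>M\<^esub> X = W" using z z' coset_zero[OF W] by simp
      then show ?case using z'(1) by auto
    qed (auto simp: a_ac zero add0)
  qed (clarsimp simp: smult_l_distr smult_r_distr smult_assoc1 smult_one simp del: UN_simps)+
qed

lemma vectorspace_subquotient: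
  assumes "field R" "submodule R W M" "submodule R S M"
  shows "vectorspace R (subquotient M W S)"
  using assms by (simp add: vectorspace_def module_subquotient)

lemma submodule_image:
  assumes "mod_hom R M N T" "submodule R W M"
  shows "submodule R (T ` W) N"
proof -
  interpret mod_hom R M N T by fact
  interpret W: submodule R W M by fact
  show ?thesis
  proof (rule submodule.intro)
    show "Module.module R N" by (rule N.module_axioms)
    show "T ` W \<subseteq> carrier N" using W.subset by auto
    show "\<zero>\<^bsub>N\<^esub> \<in> T ` W" using W.zero_closed f0_is_0 by (metis imageI)
    show "v \<oplus>\<^bsub>N\<^esub> w \<in> T ` W" if vw: "v \<in> T ` W" "w \<in> T ` W" for v w
    proof -
      from vw obtain x y where "x \<in> W" "y \<in> W" "v = T x" "w = T y" by auto
      then show ?thesis using W.subset by (intro image_eqI[of _ _ "x \<oplus>\<^bsub>M\<^esub> y"]) (auto simp: subsetD)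
    qed
    show "a \<odot>\<^bsub>N\<^esub> w \<in> T ` W" if "a \<in> carrier R" "w \<in> T ` W" for a w
    proof -
      from that obtain x where "x \<in> W" "w = T x" by auto
      then show ?thesis using W.subset that
        by (intro image_eqI[of _ _ "a \<odot>\<^bsub>M\<^esub> x"]) (auto simp: subsetD)
    qed
  qed
qed

text \<open>
  An injective homomorphism \<open>T\<close> induces the map \<open>X \<mapsto> T ` X\<close> on cosets. It is injective because
  taking images under an injective function is, and it hits every coset of \<open>T ` W\<close> that has a
  representative in \<open>T ` S\<close>, hence it is an isomorphism of the subquotients.
\<close>

lemma dim_subquotient_image:
  assumes "field F" and T: "mod_hom F M N T" "inj_on T (carrier M)"
    and W: "submodule F W M" and S: "submodule F S M"
  shows "vectorspace.dim F (subquotient N (T ` W) (T ` S)) = vectorspace.dim F (subquotient M W S)"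
proof -
  interpret mod_hom F M N T by fact
  interpret W: submodule F W M by fact
  interpret S: submodule F S M by fact
  note W' = submodule_image[OF T(1) W] and S' = submodule_image[OF T(1) S]
  note W.subset[THEN subsetD, simp] S.subset[THEN subsetD, simp]
  have coset: "T ` (W +>\<^bsub>M\<^esub> z) = T ` W +>\<^bsub>N\<^esub> T z" if "z \<in> S" for z
    using that by (force simp: a_r_coset_def')
  have coset_sub: "W +>\<^bsub>M\<^esub> z \<subseteq> carrier M" if "z \<in> S" for z
    using that by (auto simp: a_r_coset_def')
  have "linear_map F (subquotient M W S) (subquotient N (T ` W) (T ` S)) (image T)"
    unfolding linear_map_def mod_hom_def mod_hom_axioms_def module_hom_def
  proof (intro conjI CollectI allI impI; (elim conjE)?)
    show "image T \<in> carrier (subquotient M W S) \<rightarrow> carrier (subquotient N (T ` W) (T ` S))"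
      by (auto simp: coset)
  next
    fix X Y assume "X \<in> carrier (subquotient M W S)" "Y \<in> carrier (subquotient M W S)"
    then show "T ` (X \<oplus>\<^bsub>subquotient M W S\<^esub> Y) =
        T ` X \<oplus>\<^bsub>subquotient N (T ` W) (T ` S)\<^esub> T ` Y"
      by (clarsimp simp: coset coset_add[OF W] coset_add[OF W'])
  next
    fix a X assume "a \<in> carrier F" "X \<in> carrier (subquotient M W S)"
    then show "T ` (a \<odot>\<^bsub>subquotient M W S\<^esub> X) = a \<odot>\<^bsub>subquotient N (T ` W) (T ` S)\<^esub> T ` X"
      by (clarsimp simp: coset coset_smult[OF W] coset_smult[OF W'] simp del: UN_simps)
  qed (simp_all add: vectorspace_subquotient module_subquotient assms W' S')
  moreover have "bij_betw (image T) (carrier (subquotient M W S))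
      (carrier (subquotient N (T ` W) (T ` S)))"
    unfolding bij_betw_def
  proof
    have "inj_on (image T) (Pow (carrier M))"
      using T(2) by (rule inj_on_image_Pow)
    then show "inj_on (image T) (carrier (subquotient M W S))"
      by (rule inj_on_subset) (use coset_sub in auto)
    show "image T ` carrier (subquotient M W S) = carrier (subquotient N (T ` W) (T ` S))"
      by (simp add: image_image coset cong: image_cong)
  qed
  ultimately show ?thesis using dim_linear_iso by metis
qed

section \<open>Chains as submodules of a function space\<close>

text \<open>
  A common ambient module for the chains of all complexes on one vertex type. Cycles and boundaries
  of different complexes become submodules of the same module, which makes them comparable.
\<close>

definition function_space :: "('f, 'm) ring_scheme \<Rightarrow> ('f, 'b \<Rightarrow> 'f) module" where
  "function_space F =
     \<lparr>carrier = {c. \<forall>x. c x \<in> carrier F}, monoid.mult = undefined, one = undefined,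
      zero = (\<lambda>_. \<zero>\<^bsub>F\<^esub>), add = (\<lambda>c c' x. c x \<oplus>\<^bsub>F\<^esub> c' x),
      smult = (\<lambda>a c x. a \<otimes>\<^bsub>F\<^esub> c x)\<rparr>"

lemma function_space_simps [simp]:
  "carrier (function_space F) = {c. \<forall>x. c x \<in> carrier F}"
  "zero (function_space F) = (\<lambda>_. \<zero>\<^bsub>F\<^esub>)"
  "c \<oplus>\<^bsub>function_space F\<^esub> c' = (\<lambda>x. c x \<oplus>\<^bsub>F\<^esub> c' x)"
  "a \<odot>\<^bsub>function_space F\<^esub> c = (\<lambda>x. a \<otimes>\<^bsub>F\<^esub> c x)"
  by (simp_all add: function_space_def)

lemma module_function_space:
  assumes "cring F"
  shows "module F (function_space F)"
proof -
  interpret cring F by fact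
  show ?thesis
  proof (rule moduleI)
    show "abelian_group (function_space F)"
    proof (rule abelian_groupI, goal_cases)
      case (6 c)
      then show ?case by (auto intro!: exI[of _ "\<lambda>x. \<ominus>\<^bsub>F\<^esub> c x"] simp: l_neg)
    qed (auto simp: a_ac)
  qed (auto simp: assms l_distr r_distr m_assoc)
qed

lemma permute_list_in_ordered_simplices_iff:
  assumes "p permutes {..k}" "length xs = Suc k"
  shows "permute_list p xs \<in> ordered_simplices K k \<longleftrightarrow> xs \<in> ordered_simplices K k"
proof -
  have "p permutes {..<length xs}" using assms by (simp add: lessThan_Suc_atMost)
  then show ?thesis by (simp add: ordered_simplices_def)
qed

lemma chains_D:
  assumes "c \<in> chains F K k"
  shows "c xs \<in> carrier F"
    and "xs \<notin> ordered_simplices K k \<Longrightarrow> c xs = \<zero>\<^bsub>F\<^esub>"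
  using assms by (auto simp: chains_def)

lemma submodule_chains:
  assumes "cring F"
  shows "submodule F (chains F K k) (function_space F)"
proof -
  interpret cring F by fact
  show ?thesis
    by (rule submodule.intro)
      (auto simp: chains_def module_function_space assms minus_add r_minus)
qed

text \<open>
  Finiteness keeps the sum that defines the boundary meaningful: a sum over an infinite set is zero
  by convention.
\<close>

lemma finite_cofaces:
  assumes "finite K"
  shows "finite {x. x # ys \<in> ordered_simplices K k}"
proof (rule finite_subset)
  show "{x. x # ys \<in> ordered_simplices K k} \<subseteq>
      \<Union>{simplex_vertices \<sigma> |\<sigma>. \<sigma> \<in> K \<and> finite (simplex_vertices \<sigma>)}"
  proof
    fix x assume "x \<in> {x. x # ys \<in> ordered_simplices K k}"
    then obtain \<sigma> where "\<sigma> \<in> K" "set (x # ys) = simplex_vertices \<sigma>"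
      by (auto simp: ordered_simplices_def)
    moreover from this have "finite (simplex_vertices \<sigma>)" "x \<in> simplex_vertices \<sigma>"
      by (metis finite_set, metis list.set_intros(1))
    ultimately show "x \<in> \<Union>{simplex_vertices \<sigma> |\<sigma>. \<sigma> \<in> K \<and> finite (simplex_vertices \<sigma>)}"
      by blast
  qed
  show "finite (\<Union>{simplex_vertices \<sigma> |\<sigma>. \<sigma> \<in> K \<and> finite (simplex_vertices \<sigma>)})"
    using assms by auto
qed

lemma mod_hom_boundary_map:
  assumes "cring F" "finite K"
  shows "mod_hom F ((function_space F)\<lparr>carrier := chains F K k\<rparr>) (function_space F) (boundary_map F K k)"
proof -
  interpret cring F by fact
  have chains_module: "module F ((function_space F)\<lparr>carrier := chains F K k\<rparr>)"
    using module.submodule_is_module[OF module_function_space[OF assms(1)] submodule_chains[OF assms(1)]] .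
  note [simp] = chains_D(1) finite_cofaces[OF assms(2)]
  have "boundary_map F K k c ys \<in> carrier F" if "c \<in> chains F K k" for c ys
    using that by (auto simp: boundary_map_def intro!: finsum_closed)
  moreover have "boundary_map F K k (\<lambda>xs. c xs \<oplus>\<^bsub>F\<^esub> c' xs) ys =
      boundary_map F K k c ys \<oplus>\<^bsub>F\<^esub> boundary_map F K k c' ys"
    if "c \<in> chains F K k" "c' \<in> chains F K k" for c c' ys
    using that by (auto simp: boundary_map_def intro!: finsum_addf)
  moreover have "boundary_map F K k (\<lambda>xs. a \<otimes>\<^bsub>F\<^esub> c xs) ys = a \<otimes>\<^bsub>F\<^esub> boundary_map F K k c ys"
    if "a \<in> carrier F" "c \<in> chains F K k" for a c ys
    using that by (auto simp: boundary_map_def intro!: finsum_rdistr[symmetric])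
  ultimately show ?thesis
    using chains_module module_function_space[OF assms(1)]
    by (auto simp: mod_hom_def mod_hom_axioms_def module_hom_def fun_eq_iff)
qed

lemma submodule_boundaries:
  assumes "cring F" "finite K"
  shows "submodule F (boundaries F K k) (function_space F)"
proof -
  interpret mod_hom F "(function_space F)\<lparr>carrier := chains F K (Suc k)\<rparr>" "function_space F"
    "boundary_map F K (Suc k)"
    using assms by (rule mod_hom_boundary_map)
  show ?thesis using im_is_submodule by (simp add: im_def boundaries_def)
qed

lemma submodule_cycles:
  assumes "cring F" "finite K"
  shows "submodule F (cycles F K k) (function_space F)"
proof -
  interpret mod_hom F "(function_space F)\<lparr>carrier := chains F K k\<rparr>" "function_space F"
    "boundary_map F K k"
    using assms by (rule mod_hom_boundary_map)
  interpret cycles: submodule F "cycles F K k" "(function_space F)\<lparr>carrier := chains F K k\<rparr>"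
    using ker_is_submodule by (simp add: ker_def cycles_def)
  show ?thesis
  proof (rule submodule.intro)
    show "module F (function_space F)" using assms(1) by (rule module_function_space)
    show "cycles F K k \<subseteq> carrier (function_space F)"
      by (auto simp: cycles_def chains_D(1))
  qed (use cycles.m_closed cycles.zero_closed cycles.smult_closed in simp_all)
qed

lemma ordered_simplices_mono: "K \<subseteq> L \<Longrightarrow> ordered_simplices K k \<subseteq> ordered_simplices L k"
  by (auto simp: ordered_simplices_def)

text \<open>
  A chain of a subcomplex is extended by zero. The alternating condition survives because a list
  and its permutations have the same vertex set and hence lie in the same subcomplexes.
\<close>

lemma chains_mono:
  assumes "cring F" "K \<subseteq> L"
  shows "chains F K k \<subseteq> chains F L k"
proof
  interpret cring F by fact
  fix c assume c: "c \<in> chains F K k"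
  have "c (permute_list p xs) = (if evenperm p then c xs else \<ominus>\<^bsub>F\<^esub> c xs)"
    if xs: "xs \<in> ordered_simplices L k" and p: "p permutes {..k}" for xs p
  proof (cases "xs \<in> ordered_simplices K k")
    case True
    then show ?thesis using c p by (simp add: chains_def)
  next
    case False
    moreover from this have "permute_list p xs \<notin> ordered_simplices K k"
      using permute_list_in_ordered_simplices_iff[OF p, of xs K] xs
      by (simp add: ordered_simplices_def)
    ultimately show ?thesis using c by (simp add: chains_D(2))
  qed
  then show "c \<in> chains F L k"
    using c ordered_simplices_mono[OF assms(2), of k] by (auto simp: chains_def)
qed

lemma boundary_map_mono:
  assumes "cring F" "finite L" "K \<subseteq> L" "c \<in> chains F K k"
  shows "boundary_map F L k c = boundary_map F K k c"
proof
  interpret cring F by fact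
  fix ys
  show "boundary_map F L k c ys = boundary_map F K k c ys"
    unfolding boundary_map_def
    using assms(4) finite_cofaces[OF assms(2)] ordered_simplices_mono[OF assms(3), of k]
    by (auto simp: chains_D intro!: add.finprod_mono_neutral_cong_right)
      (metis assms(4) chains_D(2))
qed

lemma boundaries_mono:
  assumes "cring F" "finite L" "K \<subseteq> L"
  shows "boundaries F K k \<subseteq> boundaries F L k"
  using chains_mono[OF assms(1,3), of "Suc k"] boundary_map_mono[OF assms, of _ "Suc k"]
  unfolding boundaries_def by force

text \<open>
  The projection \<open>M / U \<rightarrow> M / W\<close> for \<open>U \<subseteq> W\<close>, written as a union over representatives as in the
  maps that inclusions induce on homology.
\<close>

lemma coset_of_coset:
  assumes W: "submodule R W M" and "U \<subseteq> W" "\<zero>\<^bsub>M\<^esub> \<in> U" and z: "z \<in> carrier M"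
  shows "(\<Union>x\<in>U +>\<^bsub>M\<^esub> z. W +>\<^bsub>M\<^esub> x) = W +>\<^bsub>M\<^esub> z"
proof -
  interpret submodule R W M by fact
  interpret module R M by (rule module)
  interpret W: abelian_subgroup W M using W by (rule submodule_imp_abelian_subgroup)
  have "W +>\<^bsub>M\<^esub> x = W +>\<^bsub>M\<^esub> z" if "x \<in> U +>\<^bsub>M\<^esub> z" for x
  proof -
    have "x \<in> W +>\<^bsub>M\<^esub> z" using that assms(2) by (auto simp: a_r_coset_def')
    then show ?thesis using z a_repr_independence[OF _ _ W.a_subgroup] by simp
  qed
  moreover have "z \<in> U +>\<^bsub>M\<^esub> z"
    unfolding a_r_coset_def' using assms(3) z by (auto intro!: bexI[of _ "\<zero>\<^bsub>M\<^esub>"])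
  ultimately show ?thesis by blast
qed

text \<open>
  The class of a cycle \<open>z\<close> of \<open>K\<close> is sent to the coset of \<open>z\<close> modulo the boundaries of \<open>L\<close>, so the
  image of the homology of \<open>K\<close> in that of \<open>L\<close> consists of the cosets represented by cycles of \<open>K\<close>.
\<close>

lemma persistent_betti_eq_dim_subquotient:
  fixes K L :: "'a::euclidean_space set set"
  assumes "cring F" "finite L" "K \<subseteq> L"
  shows "persistent_betti F k K L =
    vectorspace.dim F (subquotient (function_space F) (boundaries F L k) (cycles F K k))"
proof -
  have K: "finite K" using assms(2,3) finite_subset by blast
  interpret BK: submodule F "boundaries F K k" "function_space F"
    using assms(1) K by (rule submodule_boundaries)
  note BL = submodule_boundaries[OF assms(1,2), of k]
  interpret Z: submodule F "cycles F K k" "function_space F"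
    using assms(1) K by (rule submodule_cycles)
  have coset: "W +>\<^bsub>chain_space F L k\<^esub> z = W +>\<^bsub>function_space F\<^esub> z" for W z and L :: "'a set set"
    by (simp add: a_r_coset_def' chain_space_def)
  have "carrier (homology F K k) =
      (\<lambda>z. boundaries F K k +>\<^bsub>function_space F\<^esub> z) ` cycles F K k"
    by (auto simp: homology_def quotient_module_def A_RCOSETS_def' a_r_coset_def' chain_space_def)
  moreover have "inclusion_map F L k (boundaries F K k +>\<^bsub>function_space F\<^esub> z) =
      boundaries F L k +>\<^bsub>function_space F\<^esub> z" if "z \<in> cycles F K k" for z
    unfolding inclusion_map_def coset using that Z.subset BK.zero_closed
    by (intro coset_of_coset[OF BL boundaries_mono[OF assms]]) auto
  ultimately have "inclusion_map F L k ` carrier (homology F K k) =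
      (\<lambda>z. boundaries F L k +>\<^bsub>function_space F\<^esub> z) ` cycles F K k"
    by (simp add: image_image cong: image_cong)
  then have "(homology F L k)\<lparr>carrier := inclusion_map F L k ` carrier (homology F K k)\<rparr> =
      subquotient (function_space F) (boundaries F L k) (cycles F K k)"
    by (simp add: homology_def quotient_module_def subquotient_def chain_space_def
        a_r_coset_def' set_add_def' fun_eq_iff)
  then show ?thesis by (simp add: persistent_betti_def)
qed

section \<open>Homology of linear images of complexes\<close>

lemma simplex_vertices_linear_image:
  assumes "linear g" "inj g"
  shows "simplex_vertices (g ` \<sigma>) = g ` simplex_vertices \<sigma>"
proof -
  have "g x extreme_point_of g ` \<sigma> \<longleftrightarrow> x extreme_point_of \<sigma>" for x
    using face_of_linear_image[OF assms, of "{x}" \<sigma>] by (simp add: face_of_singleton)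
  moreover have "y \<in> range g" if "y extreme_point_of g ` \<sigma>" for y
    using that by (auto simp: extreme_point_of_def)
  ultimately show ?thesis unfolding simplex_vertices_def by blast
qed

lemma map_in_ordered_simplices_iff:
  assumes "linear g" "inj g"
  shows "map g xs \<in> ordered_simplices ((`) g ` K) k \<longleftrightarrow> xs \<in> ordered_simplices K k"
  using assms(2) inj_on_subset[OF assms(2) subset_UNIV]
  by (auto simp: ordered_simplices_def simplex_vertices_linear_image[OF assms] distinct_map
      inj_image_eq_iff)

text \<open>
  Relabelling of the vertices: the coefficient at \<open>[g x\<^sub>0, \<dots>, g x\<^sub>k]\<close> is the old coefficient at
  \<open>[x\<^sub>0, \<dots>, x\<^sub>k]\<close>. The inverse is the intended one only for a bijection \<open>g\<close>.
\<close>

definition pushforward :: "('a \<Rightarrow> 'b) \<Rightarrow> ('a list \<Rightarrow> 'f) \<Rightarrow> 'b list \<Rightarrow> 'f" where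
  "pushforward g c ys = c (map (inv_into UNIV g) ys)"

lemma pushforward_map [simp]: "inj g \<Longrightarrow> pushforward g c (map g xs) = c xs"
  by (simp add: pushforward_def)

lemma list_eq_map_of_surj:
  assumes "surj g"
  obtains xs where "ys = map g xs"
  using that[of "map (inv_into UNIV g) ys"] assms by (simp add: o_def surj_f_inv_f)

lemma inj_pushforward: "inj g \<Longrightarrow> inj (pushforward g)"
  by (rule injI) (metis ext pushforward_map)

lemma pushforward_of_map: "surj g \<Longrightarrow> pushforward g (\<lambda>xs. d (map g xs)) = d"
  by (simp add: fun_eq_iff pushforward_def o_def surj_f_inv_f)

lemma mod_hom_pushforward:
  assumes "cring F"
  shows "mod_hom F (function_space F) (function_space F) (pushforward g)"
  by (auto simp: mod_hom_def mod_hom_axioms_def module_hom_def pushforward_def fun_eq_iff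
      intro!: module_function_space assms)

lemma pushforward_in_chains_iff:
  assumes "linear g" "bij g"
  shows "pushforward g c \<in> chains F ((`) g ` K) k \<longleftrightarrow> c \<in> chains F K k"
proof -
  have inj: "inj g" and surj: "surj g" using assms(2) by (auto simp: bij_def)
  have all_iff: "(\<forall>ys. P ys) \<longleftrightarrow> (\<forall>xs. P (map g xs))" for P
    by (metis list_eq_map_of_surj[OF surj])
  have perm: "permute_list p (map g xs) = map g (permute_list p xs)"
    if "xs \<in> ordered_simplices K k" "p permutes {..k}" for p xs
    using that by (auto simp: ordered_simplices_def permute_list_map lessThan_Suc_atMost)
  show ?thesis
    unfolding chains_def Ball_def mem_Collect_eq all_iff map_in_ordered_simplices_iff[OF assms(1) inj]
    using perm by (simp add: inj)
qed

lemma chains_linear_image: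
  assumes "linear g" "bij g"
  shows "chains F ((`) g ` K) k = pushforward g ` chains F K k"
proof (intro equalityI subsetI)
  fix d assume d: "d \<in> chains F ((`) g ` K) k"
  have d_eq: "d = pushforward g (\<lambda>xs. d (map g xs))"
    using assms(2) by (simp add: pushforward_of_map bij_def)
  then show "d \<in> pushforward g ` chains F K k"
    using d pushforward_in_chains_iff[OF assms] by (metis imageI)
qed (use pushforward_in_chains_iff[OF assms] in auto)

text \<open>
  The chain map property. The simplices that have \<open>[g x\<^sub>1, \<dots>, g x\<^sub>k]\<close> as a face are the images of
  those that have \<open>[x\<^sub>1, \<dots>, x\<^sub>k]\<close> as a face, and so both sums agree after reindexing along \<open>g\<close>.
\<close>

lemma boundary_map_pushforward:
  assumes "cring F" "linear g" "bij g" "c \<in> chains F K k"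
  shows "boundary_map F ((`) g ` K) k (pushforward g c) = pushforward g (boundary_map F K k c)"
proof
  interpret cring F by fact
  have inj: "inj g" and surj: "surj g" using assms(3) by (auto simp: bij_def)
  fix ys
  obtain xs where ys: "ys = map g xs" using surj by (rule list_eq_map_of_surj)
  have iff: "g x # map g xs \<in> ordered_simplices ((`) g ` K) k \<longleftrightarrow> x # xs \<in> ordered_simplices K k" for x
    using map_in_ordered_simplices_iff[OF assms(2) inj, of "x # xs" K k] by simp
  have cofaces: "{y. y # ys \<in> ordered_simplices ((`) g ` K) k} = g ` {x. x # xs \<in> ordered_simplices K k}"
    unfolding ys using surj iff by (auto simp: image_iff) (metis surjD)
  have push: "pushforward g c (g x # ys) = c (x # xs)" for x
    using pushforward_map[OF inj, of c "x # xs"] by (simp add: ys)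
  have "boundary_map F ((`) g ` K) k (pushforward g c) ys = boundary_map F K k c xs"
    unfolding boundary_map_def cofaces
    using chains_D(1)[OF assms(4)] inj_on_subset[OF inj subset_UNIV]
    by (subst add.finprod_reindex) (auto simp: push)
  then show "boundary_map F ((`) g ` K) k (pushforward g c) ys = pushforward g (boundary_map F K k c) ys"
    by (simp add: ys inj)
qed

lemma boundaries_linear_image:
  assumes "cring F" "linear g" "bij g"
  shows "boundaries F ((`) g ` K) k = pushforward g ` boundaries F K k"
  unfolding boundaries_def chains_linear_image[OF assms(2,3)] image_image
  using boundary_map_pushforward[OF assms] by (simp cong: image_cong)

lemma cycles_linear_image:
  assumes "cring F" "linear g" "bij g"
  shows "cycles F ((`) g ` K) k = pushforward g ` cycles F K k"
proof -
  have "pushforward g (\<lambda>_. \<zero>\<^bsub>F\<^esub>) = (\<lambda>_. \<zero>\<^bsub>F\<^esub>)"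
    by (simp add: pushforward_def fun_eq_iff)
  then have "pushforward g z = (\<lambda>_. \<zero>\<^bsub>F\<^esub>) \<longleftrightarrow> z = (\<lambda>_. \<zero>\<^bsub>F\<^esub>)" for z
    using inj_pushforward[OF bij_is_inj[OF assms(3)]] by (metis injD)
  then show ?thesis
    unfolding cycles_def chains_linear_image[OF assms(2,3)]
    using boundary_map_pushforward[OF assms] by auto
qed

text \<open>
  The push-forward is an injective linear map that carries the cycles of the small complex and the
  boundaries of the large one to those of the image complexes, so the two subquotients are isomorphic.
\<close>

lemma persistent_betti_linear_image:
  assumes "field F" "finite L" "K \<subseteq> L" "linear g" "bij g"
  shows "persistent_betti F k ((`) g ` K) ((`) g ` L) = persistent_betti F k K L"
proof -
  interpret field F by fact
  have "finite K" using assms(2,3) finite_subset by blast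
  then show ?thesis
    using assms mod_hom_pushforward[OF is_cring, of g]
    by (simp add: persistent_betti_eq_dim_subquotient image_mono is_cring
        boundaries_linear_image cycles_linear_image inj_on_subset[OF inj_pushforward] bij_is_inj
        dim_subquotient_image submodule_boundaries submodule_cycles)
qed

section \<open>Filtrations and persistence diagrams\<close>

lemma simplex_vertices_finite_nonempty:
  assumes "simplicial_complex_on V K" "\<sigma> \<in> K" "\<sigma> \<noteq> {}"
  shows "finite (simplex_vertices \<sigma>)" "simplex_vertices \<sigma> \<noteq> {}"
proof -
  obtain C where C: "\<not> affine_dependent C" "\<sigma> = convex hull C"
    using assms unfolding simplicial_complex_on_def by blast
  then have "simplex_vertices \<sigma> = C"
    by (simp add: simplex_vertices_def extreme_point_of_convex_hull_affine_independent)
  then show "finite (simplex_vertices \<sigma>)" "simplex_vertices \<sigma> \<noteq> {}"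
    using C assms(3) by (auto simp: aff_independent_finite)
qed

text \<open>
  A monotone function commutes with the maximum over the vertices of a simplex. The empty simplex
  is treated apart, since it belongs to every sublevel complex and its maximum is meaningless.
\<close>

lemma sublevel_complex_linear_image:
  assumes K: "simplicial_complex_on V K" and g: "linear g" "inj g"
    and \<phi>: "strict_mono \<phi>" and f': "\<And>x. f' (g x) = \<phi> (f x)"
  shows "sublevel_complex ((`) g ` K) f' (\<phi> t) = (`) g ` sublevel_complex K f t"
proof -
  have "Max (f' ` simplex_vertices (g ` \<sigma>)) = \<phi> (Max (f ` simplex_vertices \<sigma>))"
    if "\<sigma> \<in> K" "\<sigma> \<noteq> {}" for \<sigma>
    using simplex_vertices_finite_nonempty[OF K that]
    by (simp add: simplex_vertices_linear_image g image_image f'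
        mono_Max_commute[OF strict_mono_mono[OF \<phi>]])
  then have "{\<sigma> \<in> K. g ` \<sigma> \<noteq> {} \<longrightarrow> Max (f' ` simplex_vertices (g ` \<sigma>)) \<le> \<phi> t} =
      {\<sigma> \<in> K. \<sigma> \<noteq> {} \<longrightarrow> Max (f ` simplex_vertices \<sigma>) \<le> t}"
    using strict_mono_less_eq[OF \<phi>] by (intro Collect_cong) (metis image_is_empty)
  moreover have "{\<tau> \<in> (`) g ` K. P \<tau>} = (`) g ` {\<sigma> \<in> K. P (g ` \<sigma>)}" for P
    by blast
  ultimately show ?thesis by (simp add: sublevel_complex_def)
qed

lemma sorted_list_of_set_strict_mono_image:
  assumes "finite A" "strict_mono \<phi>"
  shows "sorted_list_of_set (\<phi> ` A) = map \<phi> (sorted_list_of_set A)"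
proof -
  have "sorted_wrt (<) (map \<phi> (sorted_list_of_set A))"
    using strict_sorted_list_of_set[of A] strict_mono_less[OF assms(2)]
    by (simp add: sorted_wrt_map)
  moreover have "card (\<phi> ` A) = card A"
    using strict_mono_imp_inj_on[OF assms(2)] by (rule card_image)
  ultimately show ?thesis
    using assms(1) by (subst sorted_list_of_set_unique[symmetric]) auto
qed

lemma filtration_values_mono:
  assumes "1 \<le> i" "i \<le> j" "j \<le> card (f ` V)"
  shows "filtration_values V f i \<le> filtration_values V f j"
  unfolding filtration_values_def using assms by (intro sorted_nth_mono) auto

lemma filtration_mono:
  assumes "i \<le> j" "j \<le> card (f ` V)"
  shows "filtration V K f i \<subseteq> filtration V K f j"
proof (cases "i = 0")
  case False
  then have "filtration_values V f i \<le> filtration_values V f j"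
    using assms by (intro filtration_values_mono) auto
  then show ?thesis
    using False assms(1) by (auto simp: filtration_def sublevel_complex_def)
qed (simp add: filtration_def)

text \<open>
  Let the heights on the image of \<open>V\<close> be the old heights after a strictly increasing
  reparametrisation \<open>\<phi>\<close>. Then \<open>\<phi>\<close> preserves the order of the critical values, the filtrations
  correspond step by step, and only the labels of the points of the diagram change.
\<close>

context
  fixes V :: "'a::euclidean_space set" and K :: "'a set set" and f :: "'a \<Rightarrow> real"
    and g :: "'a \<Rightarrow> 'b::euclidean_space" and f' :: "'b \<Rightarrow> real" and \<phi> :: "real \<Rightarrow> real"
  assumes K: "simplicial_complex_on V K" and g: "linear g" "bij g"
    and \<phi>: "strict_mono \<phi>" and f': "\<And>x. f' (g x) = \<phi> (f x)"
begin

lemma image_values: "f' ` g ` V = \<phi> ` f ` V"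
  by (simp add: image_image f')

lemma card_image_values: "card (f' ` g ` V) = card (f ` V)"
  unfolding image_values using strict_mono_imp_inj_on[OF \<phi>] by (rule card_image)

lemma filtration_values_linear_image:
  assumes "1 \<le> i" "i \<le> card (f ` V)"
  shows "filtration_values (g ` V) f' i = \<phi> (filtration_values V f i)"
proof -
  have "finite (f ` V)" using K by (simp add: simplicial_complex_on_def)
  then show ?thesis
    using assms by (simp add: filtration_values_def image_values \<phi> sorted_list_of_set_strict_mono_image)
qed

lemma filtration_linear_image:
  assumes "i \<le> card (f ` V)"
  shows "filtration (g ` V) ((`) g ` K) f' i = (`) g ` filtration V K f i"
  using assms
  by (simp add: filtration_def filtration_values_linear_image
      sublevel_complex_linear_image[where f = f and f' = f', OF K g(1) bij_is_inj[OF g(2)] \<phi> f'])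

lemma persistent_betti_filtration_linear_image:
  assumes "field F" "i \<le> j" "j \<le> card (f ` V)"
  shows "persistent_betti F k (filtration (g ` V) ((`) g ` K) f' i) (filtration (g ` V) ((`) g ` K) f' j) =
    persistent_betti F k (filtration V K f i) (filtration V K f j)"
proof -
  have "finite K" using K by (simp add: simplicial_complex_on_def simplicial_complex_def)
  then have "finite (filtration V K f j)"
    by (simp add: filtration_def sublevel_complex_def)
  then show ?thesis
    using assms filtration_mono[OF assms(2,3), of K]
    by (simp add: filtration_linear_image persistent_betti_linear_image g)
qed

text \<open>
  The multiplicities are built from the ranks of the maps between steps \<open>i \<le> j\<close> of the filtration,
  which agree for both complexes. The births and deaths, including the death time \<open>Max (f ` V)\<close> of
  the classes that never die, are transformed by \<open>\<phi>\<close>.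
\<close>

lemma persistence_diagram_linear_image:
  assumes "field F"
  shows "persistence_diagram F k (g ` V) ((`) g ` K) f' =
    image_mset (map_prod \<phi> \<phi>) (persistence_diagram F k V K f)"
proof -
  have image_mset_sum: "image_mset h (\<Sum>x\<in>A. D x) = (\<Sum>x\<in>A. image_mset h (D x))"
    for h :: "real \<times> real \<Rightarrow> real \<times> real" and D and A :: "nat set"
    by (induction A rule: infinite_finite_induct) auto
  \<comment> \<open>The diagram refers to the maximal height only if there is at least one critical value.\<close>
  have Max: "Max (f' ` g ` V) = \<phi> (Max (f ` V))" if "card (f ` V) \<noteq> 0"
    unfolding image_values using that
    by (subst mono_Max_commute[OF strict_mono_mono[OF \<phi>]]) (auto simp: card_eq_0_iff)
  note betti = persistent_betti_filtration_linear_image[OF assms]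
  show ?thesis
    unfolding persistence_diagram_def Let_def card_image_values image_mset_union image_mset_sum
      image_replicate_mset map_prod_simp
  proof (intro arg_cong2[of _ _ _ _ "(+)"] sum.cong refl)
    fix i j assume "i \<in> {1..card (f ` V)}" "j \<in> {i<..card (f ` V)}"
    then have "1 \<le> i" "i \<le> j" "j \<le> card (f ` V)" "i \<le> j - 1" "i - 1 \<le> j - 1" "i - 1 \<le> j"
      "j - 1 \<le> card (f ` V)" "i \<le> card (f ` V)" "1 \<le> j" by auto
    note bounds = this
    show "replicate_mset
        (persistent_betti F k (filtration (g ` V) ((`) g ` K) f' i) (filtration (g ` V) ((`) g ` K) f' (j - 1)) -
         persistent_betti F k (filtration (g ` V) ((`) g ` K) f' i) (filtration (g ` V) ((`) g ` K) f' j) -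
         (persistent_betti F k (filtration (g ` V) ((`) g ` K) f' (i - 1)) (filtration (g ` V) ((`) g ` K) f' (j - 1)) -
          persistent_betti F k (filtration (g ` V) ((`) g ` K) f' (i - 1)) (filtration (g ` V) ((`) g ` K) f' j)))
        (filtration_values (g ` V) f' i, filtration_values (g ` V) f' j) =
      replicate_mset
        (persistent_betti F k (filtration V K f i) (filtration V K f (j - 1)) -
         persistent_betti F k (filtration V K f i) (filtration V K f j) -
         (persistent_betti F k (filtration V K f (i - 1)) (filtration V K f (j - 1)) -
          persistent_betti F k (filtration V K f (i - 1)) (filtration V K f j)))
        (\<phi> (filtration_values V f i), \<phi> (filtration_values V f j))"
      by (simp only: bounds betti filtration_values_linear_image)
  next
    fix i assume "i \<in> {1..card (f ` V)}"
    then have "1 \<le> i" "i \<le> card (f ` V)" "i - 1 \<le> card (f ` V)" "card (f ` V) \<noteq> 0" by auto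
    note bounds = this
    show "replicate_mset
        (persistent_betti F k (filtration (g ` V) ((`) g ` K) f' i) (filtration (g ` V) ((`) g ` K) f' (card (f ` V))) -
         persistent_betti F k (filtration (g ` V) ((`) g ` K) f' (i - 1)) (filtration (g ` V) ((`) g ` K) f' (card (f ` V))))
        (filtration_values (g ` V) f' i, Max (f' ` g ` V)) =
      replicate_mset
        (persistent_betti F k (filtration V K f i) (filtration V K f (card (f ` V))) -
         persistent_betti F k (filtration V K f (i - 1)) (filtration V K f (card (f ` V))))
        (\<phi> (filtration_values V f i), \<phi> (Max (f ` V)))"
      by (simp only: bounds betti filtration_values_linear_image Max[OF bounds(4)] order_refl)
  qed
qed

end

section \<open>Scale invariance of persistent entropy\<close>

text \<open>
  All lifetimes and their total are multiplied by \<open>c\<close>, so the proportions \<open>p\<^sub>i\<close> do not change.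
\<close>

lemma persistent_entropy_scale:
  assumes "c \<noteq> 0"
  shows "persistent_entropy (image_mset (map_prod ((*) c) ((*) c)) D) = persistent_entropy D"
proof -
  have total: "(\<Sum>(b, d)\<in>#image_mset (map_prod ((*) c) ((*) c)) D. d - b) = c * (\<Sum>(b, d)\<in>#D. d - b)"
    by (simp add: multiset.map_comp comp_def case_prod_unfold sum_mset_distrib_left right_diff_distrib)
  have share: "(case map_prod ((*) c) ((*) c) x of (b, d) \<Rightarrow> (d - b) / (c * L)) =
      (case x of (b, d) \<Rightarrow> (d - b) / L)" for x and L :: real
    using assms by (cases x) (simp flip: right_diff_distrib)
  show ?thesis
    unfolding persistent_entropy_def Let_def
    unfolding total
    unfolding multiset.map_comp comp_def share
    using assms by simp
qed

theorem proposition4: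
  fixes F :: "('f, 'm) ring_scheme"
    and V :: "(real ^ 'n) set"
    and K :: "(real ^ 'n) set set"
    and k :: nat
    and c :: real
  assumes "field F"
    and "simplicial_complex_on V K"
    and "k \<le> CARD('n)"
    and "c > 0"
  shows "PET F k ((*\<^sub>R) c ` V) (scale_complex c K) = PET F k V K"
proof -
  have "linear ((*\<^sub>R) c :: real ^ 'n \<Rightarrow> real ^ 'n)" by simp
  moreover have "bij ((*\<^sub>R) c :: real ^ 'n \<Rightarrow> real ^ 'n)"
    using assms(4) by (intro bijI injI surjI[of _ "(*\<^sub>R) (inverse c)"]) auto
  moreover have "strict_mono ((*) c)" using assms(4) by (simp add: strict_mono_def)
  moreover have "height v (c *\<^sub>R x) = c * height v x" for v x :: "real ^ 'n"
    by (simp add: height_def)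
  ultimately have "persistence_diagram F k ((*\<^sub>R) c ` V) (scale_complex c K) (height v) =
      image_mset (map_prod ((*) c) ((*) c)) (persistence_diagram F k V K (height v))" for v
    unfolding scale_complex_def
    using persistence_diagram_linear_image[OF assms(2) _ _ _ _ assms(1)] by blast
  then show ?thesis
    using assms(4) by (simp add: PET_def persistent_entropy_scale)
qed

end
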